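(* Consider the $P_3$ causal structure with three parties, each with a binary setting and a binary outcome, and let $\mathcal{L}_{P_3}$ be the associated (in general non-convex) local polytope. Let $D=\mathbf{e}_{S_0,S_1}\otimes\mathbf{e}_{T_0,T_1}\otimes\mathbf{e}_{U_0,U_1}$ and $D'=\mathbf{e}'_{S_0,S_1}\otimes\mathbf{e}'_{T_0,T_1}\otimes\mathbf{e}'_{U_0,U_1}$ be two deterministic local strategies, representing extremal points of the local polytope. Then the points of $\mathcal{L}_{P_3}$ corresponding to $D$ and $D'$ are connected by a line segment lying inside $\mathcal{L}_{P_3}$ if and only if $\mathbf{e}_{S_0,S_1}=\mathbf{e}'_{S_0,S_1}$ or $\mathbf{e}_{U_0,U_1}=\mathbf{e}'_{U_0,U_1}$.
   Context: Three parties have binary setting variables $S,T,U$ and binary outcome variables $X,Y,Z$ respectively (values in $\{0,1\}$). The $P_3$ causal structure is a path of three nodes (first, middle and third party): the first and middle parties share one source of classical randomness, the middle and third parties share another independent one, and there is no source shared by the first and third parties. The local polytope $\mathcal{L}_{P_3}$ is the set of behaviours $(P(xyz|stu))_{x,y,z,s,t,u\in\{0,1\}}$ that can be written as $$P(xyz|stu)=\sum_{\lambda,\lambda'}P(x|s,\lambda)\,P(y|t,\lambda,\lambda')\,P(z|u,\lambda')\,P_\Lambda(\lambda)\,P_{\Lambda'}(\lambda'),$$ where $P_\Lambda$, $P_{\Lambda'}$ are probability distributions and the other factors are conditional probability distributions. (Equivalently, a behaviour is recorded by the 26 coordinates consisting of the probabilities that the single parties, pairs of parties, and the triple of parties obtain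 outcome $0$, for each choice of their settings; this is an affine reparametrization of the no-signalling behaviours.) This set is called a polytope in spite of not being convex. A deterministic strategy for one party is a map $\{0,1\}\to\{0,1\}$ from settings to outcomes. It is encoded by one of the four canonical basis vectors of $\mathbb{R}^4$: for the first party, $\mathbf{e}_{i,j}$ with $i,j\in\{0,1\}$ denotes the strategy that outputs $i$ on setting $0$ and $j$ on setting $1$; $\mathbf{e}_{S_0,S_1}$ denotes such a vector for the first party, and similarly $\mathbf{e}_{T_0,T_1}$ for the middle party and $\mathbf{e}_{U_0,U_1}$ for the third party. A deterministic local strategy $D=\mathbf{e}_{S_0,S_1}\otimes\mathbf{e}_{T_0,T_1}\otimes\mathbf{e}_{U_0,U_1}$ is a choice of one deterministic strategy per party (64 in total). The corresponding point is the behaviour in which $P(xyz|stu)=1$ if $x,y,z$ are the outputs of the three chosen maps on $s,t,u$, and $0$ otherwise. *)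

theory Defs
  imports "HOL-Probability.Probability"
begin

text \<open>
  Settings and outcomes in \<open>{0,1}\<close> are booleans, \<open>False\<close> for 0 and \<open>True\<close> for 1.
  The coordinate \<open>(x, y, z, s, t, u)\<close> of a behaviour is \<open>P(xyz|stu)\<close>.
\<close>

type_synonym behaviour = "real ^ (bool \<times> bool \<times> bool \<times> bool \<times> bool \<times> bool)"

text \<open>
  The hidden variables range over \<open>nat\<close>; since the distributions are arbitrary
  probability mass functions, this covers all finite and countable alphabets.
  The families \<open>A\<close>, \<open>B\<close>, \<open>C\<close> are the response functions \<open>P(x|s,\<lambda>)\<close>, \<open>P(y|t,\<lambda>,\<lambda>')\<close>
  and \<open>P(z|u,\<lambda>')\<close>.
\<close>

definition local_polytope_P3 :: "behaviour set" where
  "local_polytope_P3 =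
    {P. \<exists>(p :: nat pmf) (q :: nat pmf)
         (A :: bool \<Rightarrow> nat \<Rightarrow> bool pmf)
         (B :: bool \<Rightarrow> nat \<Rightarrow> nat \<Rightarrow> bool pmf)
         (C :: bool \<Rightarrow> nat \<Rightarrow> bool pmf).
       \<forall>x y z s t u. P $ (x, y, z, s, t, u) =
         (\<Sum>\<^sub>\<infinity>(l, m)\<in>UNIV.
            pmf (A s l) x * pmf (B t l m) y * pmf (C u m) z * pmf p l * pmf q m)}"

text \<open>The vector of the strategy that outputs \<open>i\<close> on setting 0 and \<open>j\<close> on setting 1.\<close>

definition strategy_vec :: "bool \<Rightarrow> bool \<Rightarrow> real ^ (bool \<times> bool)" where
  "strategy_vec i j = axis (i, j) 1"

definition tensor :: "real ^ 'a \<Rightarrow> real ^ 'b \<Rightarrow> real ^ ('a \<times> 'b)" (infixr \<open>\<otimes>\<close> 70) where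
  "v \<otimes> w = vec_lambda (\<lambda>(i, j). v $ i * w $ j)"

fun strategy_output :: "bool \<times> bool \<Rightarrow> bool \<Rightarrow> bool" where
  "strategy_output (i, j) s = (if s then j else i)"

text \<open>
  The behaviour of a vector of weights on the 64 triples of strategies; on a
  product of three strategy vectors it is the corresponding deterministic
  behaviour, see \<open>behaviour_of_deterministic\<close>.
\<close>

definition behaviour_of ::
    "real ^ ((bool \<times> bool) \<times> (bool \<times> bool) \<times> (bool \<times> bool)) \<Rightarrow> behaviour" where
  "behaviour_of D = vec_lambda (\<lambda>(x, y, z, s, t, u).
     \<Sum>(a, b, c)\<in>UNIV. D $ (a, b, c) *
       of_bool (strategy_output a s = x \<and> strategy_output b t = y \<and> strategy_output c u = z))"

lemma behaviour_of_deterministic: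
  "behaviour_of (strategy_vec S0 S1 \<otimes> strategy_vec T0 T1 \<otimes> strategy_vec U0 U1)
     $ (x, y, z, s, t, u) =
   (if x = (if s then S1 else S0) \<and> y = (if t then T1 else T0) \<and> z = (if u then U1 else U0)
    then 1 else 0)"
proof -
  let ?D = "strategy_vec S0 S1 \<otimes> strategy_vec T0 T1 \<otimes> strategy_vec U0 U1"
  let ?f = "\<lambda>(a, b, c). (of_bool (strategy_output a s = x \<and> strategy_output b t = y
    \<and> strategy_output c u = z) :: real)"
  have D: "?D $ d = (if d = ((S0, S1), (T0, T1), (U0, U1)) then 1 else 0)" for d
    by (cases d) (simp add: tensor_def strategy_vec_def axis_def)
  have "behaviour_of ?D $ (x, y, z, s, t, u) = (\<Sum>d\<in>UNIV. ?D $ d * ?f d)"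
    by (simp add: behaviour_of_def case_prod_unfold)
  also have "\<dots> = (\<Sum>d\<in>UNIV. if d = ((S0, S1), (T0, T1), (U0, U1)) then ?f d else 0)"
    by (rule sum.cong[OF refl]) (simp only: D, simp)
  also have "\<dots> = ?f ((S0, S1), (T0, T1), (U0, U1))"
    by (subst sum.delta) simp_all
  finally show ?thesis
    by (auto simp del: split_paired_All)
qed

lemma pair_pmf_has_sum:
  fixes p q :: "nat pmf"
  shows "((\<lambda>(l, m). pmf p l * pmf q m) has_sum 1) UNIV"
proof -
  have eq: "(\<lambda>(l, m). pmf p l * pmf q m) = pmf (pair_pmf p q)"
    by (auto simp: pmf_pair fun_eq_iff)
  have a: "Infinite_Set_Sum.abs_summable_on (pmf (pair_pmf p q)) UNIV"
    by (rule pmf_abs_summable)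
  then have "(\<lambda>x. norm (pmf (pair_pmf p q) x)) summable_on UNIV"
    using abs_summable_equivalent by blast
  then have s: "pmf (pair_pmf p q) summable_on UNIV" by simp
  have "infsum (pmf (pair_pmf p q)) UNIV = 1"
    using infsetsum_infsum[OF a] infsetsum_pmf_eq_1[of "pair_pmf p q" UNIV] by simp
  with s show ?thesis unfolding eq by (metis has_sum_infsum)
qed

lemma local_polytope_P3_bounds:
  assumes "P \<in> local_polytope_P3"
  shows "0 \<le> P $ i \<and> P $ i \<le> 1"
proof -
  obtain x y z s t u where i: "i = (x, y, z, s, t, u)" by (cases i)
  from assms obtain p q A B C where H: "\<forall>x y z s t u. P $ (x, y, z, s, t, u) =
      (\<Sum>\<^sub>\<infinity>(l, m)\<in>UNIV.
        pmf (A s l) x * pmf (B t l m) y * pmf (C u m) z * pmf (p :: nat pmf) l * pmf (q :: nat pmf) m)"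
    unfolding local_polytope_P3_def mem_Collect_eq by (elim exE) (erule that)
  let ?f = "\<lambda>(l, m). pmf (A s l) x * pmf (B t l m) y * pmf (C u m) z * pmf p l * pmf q m"
  have P: "P $ i = infsum ?f UNIV"
    unfolding i by (rule H[rule_format])
  let ?g = "\<lambda>(l, m). pmf p l * pmf q m"
  have g: "(?g has_sum 1) UNIV" by (rule pair_pmf_has_sum)
  have le: "?f d \<le> ?g d" for d
  proof (cases d)
    case (Pair l m)
    have "pmf (A s l) x * pmf (B t l m) y * pmf (C u m) z \<le> 1"
      by (intro mult_le_one mult_nonneg_nonneg pmf_le_1 pmf_nonneg)
    then have "pmf (A s l) x * pmf (B t l m) y * pmf (C u m) z * (pmf p l * pmf q m)
        \<le> pmf p l * pmf q m"
      by (intro mult_left_le_one_le mult_nonneg_nonneg pmf_nonneg)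
    then show ?thesis by (simp add: Pair mult.assoc)
  qed
  have nonneg: "0 \<le> ?f d" for d by (cases d) simp
  have "?f summable_on UNIV"
    by (rule summable_on_comparison_test[OF has_sum_imp_summable[OF g]]) (use le nonneg in blast)+
  then have "infsum ?f UNIV \<le> 1"
    using has_sum_mono[OF has_sum_infsum g] le by blast
  moreover have "0 \<le> infsum ?f UNIV"
    by (rule infsum_nonneg) (use nonneg in blast)
  ultimately show ?thesis unfolding P by (intro conjI)
qed

lemma infsum_eq_single:
  fixes f :: "'a \<Rightarrow> real"
  assumes "\<And>d. d \<noteq> a \<Longrightarrow> f d = 0"
  shows "infsum f UNIV = f a"
proof -
  have "infsum f UNIV = infsum f {a}"
    using assms by (intro infsum_cong_neutral) auto
  then show ?thesis by simp
qed

lemma return_pmf_prod: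
  "(if x = a \<and> y = b \<and> z = c then 1 else 0) =
     pmf (return_pmf a) x * pmf (return_pmf b) y * pmf (return_pmf c) z"
  by (cases "x = a"; cases "y = b"; cases "z = c"; simp)

lemma deterministic_in_local_polytope_P3:
  "behaviour_of (strategy_vec S0 S1 \<otimes> strategy_vec T0 T1 \<otimes> strategy_vec U0 U1)
     \<in> local_polytope_P3"
proof -
  let ?A = "\<lambda>s (l :: nat). return_pmf (if s then S1 else S0)"
  let ?B = "\<lambda>t (l :: nat) (m :: nat). return_pmf (if t then T1 else T0)"
  let ?C = "\<lambda>u (m :: nat). return_pmf (if u then U1 else U0)"
  let ?p = "return_pmf (0 :: nat)"
  have "behaviour_of (strategy_vec S0 S1 \<otimes> strategy_vec T0 T1 \<otimes> strategy_vec U0 U1)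
      $ (x, y, z, s, t, u) =
    (\<Sum>\<^sub>\<infinity>(l, m)\<in>UNIV.
        pmf (?A s l) x * pmf (?B t l m) y * pmf (?C u m) z * pmf ?p l * pmf ?p m)"
    (is "_ = infsum ?f UNIV") for x y z s t u
  proof -
    have "?f d = 0" if "d \<noteq> (0, 0)" for d
    proof (cases d)
      case (Pair l m)
      have "pmf ?p l = 0 \<or> pmf ?p m = 0"
        using that unfolding Pair by (auto simp: pmf_eq_0_set_pmf)
      then show ?thesis
        unfolding Pair prod.case by (elim disjE) (simp_all only: mult_zero_left mult_zero_right)
    qed
    then have "infsum ?f UNIV = ?f (0, 0)"
      by (rule infsum_eq_single)
    also have "\<dots> = behaviour_of (strategy_vec S0 S1 \<otimes> strategy_vec T0 T1 \<otimes> strategy_vec U0 U1)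
        $ (x, y, z, s, t, u)"
      unfolding behaviour_of_deterministic return_pmf_prod by simp
    finally show ?thesis
      by (rule sym)
  qed
  then show ?thesis
    unfolding local_polytope_P3_def mem_Collect_eq
    by (intro exI[of _ ?p] exI[of _ ?A] exI[of _ ?B] exI[of _ ?C] allI)
qed

lemma extreme_point_of_zero_one:
  fixes d :: "real ^ 'n"
  assumes "d \<in> X" and d01: "\<And>i. d $ i = 0 \<or> d $ i = 1"
    and X: "\<And>P i. P \<in> X \<Longrightarrow> 0 \<le> P $ i \<and> P $ i \<le> 1"
  shows "d extreme_point_of X"
  unfolding extreme_point_of_def
proof (intro conjI ballI notI)
  fix a b
  assume a: "a \<in> X" and b: "b \<in> X" and "d \<in> open_segment a b"
  then obtain r where ne: "a \<noteq> b" and r: "0 < r" "r < 1" and d: "d = (1 - r) *\<^sub>R a + r *\<^sub>R b"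
    unfolding in_segment by blast
  have "a $ i = b $ i" for i
  proof -
    have e: "d $ i = (1 - r) * a $ i + r * b $ i"
      using d by simp
    have ai: "0 \<le> a $ i" "a $ i \<le> 1" and bi: "0 \<le> b $ i" "b $ i \<le> 1"
      using X a b by blast+
    from d01[of i] show ?thesis
    proof
      assume "d $ i = 0"
      moreover have "0 \<le> (1 - r) * a $ i" "0 \<le> r * b $ i"
        using r ai bi by simp_all
      ultimately have "(1 - r) * a $ i = 0" "r * b $ i = 0"
        using e by linarith+
      then show ?thesis using r by simp
    next
      assume "d $ i = 1"
      then have "(1 - r) * (1 - a $ i) + r * (1 - b $ i) = 0"
        using e by (simp add: algebra_simps)
      moreover have "0 \<le> (1 - r) * (1 - a $ i)" "0 \<le> r * (1 - b $ i)"
        using r ai bi by simp_all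
      ultimately have "(1 - r) * (1 - a $ i) = 0" "r * (1 - b $ i) = 0"
        by linarith+
      then show ?thesis using r by simp
    qed
  qed
  then show False using ne by (simp add: vec_eq_iff)
qed fact

lemma deterministic_extreme_point:
  "behaviour_of (strategy_vec S0 S1 \<otimes> strategy_vec T0 T1 \<otimes> strategy_vec U0 U1)
     extreme_point_of local_polytope_P3"
  (is "?d extreme_point_of _")
proof (rule extreme_point_of_zero_one)
  show "?d $ i = 0 \<or> ?d $ i = 1" for i
    by (cases i) (simp only: behaviour_of_deterministic split: if_split, blast)
qed (use deterministic_in_local_polytope_P3 local_polytope_P3_bounds in blast)+

end

theory Submission
  imports Defs
begin

text \<open>
  If the two strategies agree for an outer party, say the first, then the source shared by the
  other two parties can broadcast a biased coin that tells them which strategy to play, so every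
  convex combination is local. Otherwise the outer parties have settings \<open>s\<close> and \<open>u\<close> on which both
  of their outputs differ. As the two sources are independent, whenever \<open>(x, z)\<close> and \<open>(x', z')\<close> occur
  with positive probability on \<open>s, u\<close>, so does \<open>(x, z')\<close>; the midpoint of the segment violates this.
\<close>

lemma strategy_vec_eq_iff:
  "strategy_vec i j = strategy_vec i' j' \<longleftrightarrow> i = i' \<and> j = j'"
  by (simp add: strategy_vec_def axis_eq_axis)

text \<open>The terms are dominated by the product weights \<open>pmf p l * pmf q m\<close>. Since
  \<open>infsum\<close> is 0 by default on a non-summable family, this is what allows a sum to be
  bounded below by one of its terms.\<close>

lemma response_summable:
  fixes p q :: "nat pmf" and A C :: "nat \<Rightarrow> bool pmf" and B :: "nat \<Rightarrow> nat \<Rightarrow> bool pmf"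
  shows "(\<lambda>(l, m). pmf (A l) x * pmf (B l m) y * pmf (C m) z * pmf p l * pmf q m) summable_on UNIV"
proof (rule summable_on_comparison_test[OF has_sum_imp_summable[OF pair_pmf_has_sum[of p q]]])
  fix d :: "nat \<times> nat"
  obtain l m where d: "d = (l, m)" by (cases d)
  have "pmf (A l) x * pmf (B l m) y * pmf (C m) z \<le> 1"
    by (intro mult_le_one mult_nonneg_nonneg pmf_le_1 pmf_nonneg)
  then have "pmf (A l) x * pmf (B l m) y * pmf (C m) z * (pmf p l * pmf q m) \<le> pmf p l * pmf q m"
    by (intro mult_left_le_one_le mult_nonneg_nonneg pmf_nonneg)
  then show "(case d of (l, m) \<Rightarrow> pmf (A l) x * pmf (B l m) y * pmf (C m) z * pmf p l * pmf q m)
      \<le> (case d of (l, m) \<Rightarrow> pmf p l * pmf q m)"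
    by (simp add: d mult.assoc)
  show "0 \<le> (case d of (l, m) \<Rightarrow> pmf (A l) x * pmf (B l m) y * pmf (C m) z * pmf p l * pmf q m)"
    by (simp add: d)
qed

lemma local_polytope_P3_outer_support:
  assumes P: "P \<in> local_polytope_P3"
    and nz: "P $ (x, y, z, s, t, u) \<noteq> 0" "P $ (x', y', z', s, t, u) \<noteq> 0"
  shows "\<exists>y''. P $ (x, y'', z', s, t, u) \<noteq> 0"
proof -
  from P obtain p q :: "nat pmf" and A B C where H: "\<forall>x y z s t u. P $ (x, y, z, s, t, u) =
      (\<Sum>\<^sub>\<infinity>(l, m)\<in>UNIV. pmf (A s l) x * pmf (B t l m) y * pmf (C u m) z * pmf p l * pmf q m)"
    unfolding local_polytope_P3_def mem_Collect_eq by (elim exE) (erule that)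
  let ?f = "\<lambda>x y z (l, m). pmf (A s l) x * pmf (B t l m) y * pmf (C u m) z * pmf p l * pmf q m"
  have eq: "P $ (x, y, z, s, t, u) = infsum (?f x y z) UNIV" for x y z
    by (rule H[rule_format])
  have ex: "\<exists>d. ?f x y z d \<noteq> 0" if "P $ (x, y, z, s, t, u) \<noteq> 0" for x y z
    using that infsum_0[of UNIV "?f x y z"] unfolding eq by blast
  \<comment> \<open>From the first event only the factors in \<open>l\<close> are kept, from the
    second only those in \<open>m\<close>. Independence gives the recombined pair
    \<open>(l, m)\<close> positive weight.\<close>
  obtain l where l: "pmf (A s l) x \<noteq> 0" "pmf p l \<noteq> 0"
    using ex[OF nz(1)] by auto
  obtain m where m: "pmf (C u m) z' \<noteq> 0" "pmf q m \<noteq> 0"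
    using ex[OF nz(2)] by auto
  \<comment> \<open>The middle party sees both sources and may react to the new pair in any way, so
    its outcome cannot be prescribed.\<close>
  obtain y'' where "y'' \<in> set_pmf (B t l m)"
    using set_pmf_not_empty[of "B t l m"] by blast
  then have pos: "0 < ?f x y'' z' (l, m)"
    using l m by (simp add: pmf_positive pmf_eq_0_set_pmf)
  have "infsum (?f x y'' z') {(l, m)} \<le> infsum (?f x y'' z') UNIV"
    by (rule infsum_mono2[OF _ response_summable]) auto
  with pos have "0 < P $ (x, y'', z', s, t, u)"
    unfolding eq by simp
  then show ?thesis by (intro exI[of _ y'']) simp
qed

text \<open>Each source sends one biased coin and all responses are deterministic. The coins become
  hidden variables in \<open>nat\<close> through \<open>of_bool\<close>, and \<open>l = 1\<close>
  reads the coin back.\<close>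

lemma two_coins_in_local_polytope_P3:
  fixes a :: "bool \<Rightarrow> bool \<Rightarrow> bool" and b :: "bool \<Rightarrow> bool \<Rightarrow> bool \<Rightarrow> bool"
    and c :: "bool \<Rightarrow> bool \<Rightarrow> bool" and \<alpha> \<beta> :: real
  assumes "0 \<le> \<alpha>" "\<alpha> \<le> 1" "0 \<le> \<beta>" "\<beta> \<le> 1"
    and P: "\<And>x y z s t u. P $ (x, y, z, s, t, u) =
      (\<Sum>i\<in>UNIV. \<Sum>j\<in>UNIV. of_bool (x = a s i \<and> y = b t i j \<and> z = c u j) *
        pmf (bernoulli_pmf \<alpha>) i * pmf (bernoulli_pmf \<beta>) j)"
  shows "P \<in> local_polytope_P3"
proof -
  let ?n = "of_bool :: bool \<Rightarrow> nat"
  have inj: "inj ?n" by (auto simp: inj_def)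
  let ?p = "map_pmf ?n (bernoulli_pmf \<alpha>)" and ?q = "map_pmf ?n (bernoulli_pmf \<beta>)"
  let ?A = "\<lambda>s (l :: nat). return_pmf (a s (l = 1))"
  let ?B = "\<lambda>t (l :: nat) (m :: nat). return_pmf (b t (l = 1) (m = 1))"
  let ?C = "\<lambda>u (m :: nat). return_pmf (c u (m = 1))"
  have out: "l \<in> range ?n" if "pmf (map_pmf ?n r) l \<noteq> 0" for r l
    using that by (auto simp: pmf_eq_0_set_pmf)
  have ret: "pmf (return_pmf v) w = of_bool (w = v)" for v w :: bool
    by simp
  have "P $ (x, y, z, s, t, u) = (\<Sum>\<^sub>\<infinity>(l, m)\<in>UNIV.
      pmf (?A s l) x * pmf (?B t l m) y * pmf (?C u m) z * pmf ?p l * pmf ?q m)"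
    (is "_ = infsum ?f UNIV") for x y z s t u
  proof -
    \<comment> \<open>The sources only emit 0 and 1, so four terms remain.\<close>
    have "infsum ?f UNIV = infsum ?f (range ?n \<times> range ?n)"
      by (intro infsum_cong_neutral) (auto intro: out)
    also have "\<dots> = (\<Sum>l\<in>range ?n. \<Sum>m\<in>range ?n. ?f (l, m))"
      by (simp add: sum.cartesian_product)
    also have "\<dots> = (\<Sum>i\<in>UNIV. \<Sum>j\<in>UNIV. ?f (?n i, ?n j))"
      by (simp only: sum.reindex[OF inj] o_def)
    also have "\<dots> = P $ (x, y, z, s, t, u)"
      unfolding P prod.case pmf_map_inj'[OF inj] ret
      by (intro sum.cong refl) (simp only: of_bool_conj of_bool_eq_1_iff mult.assoc)
    finally show ?thesis by (rule sym)
  qed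
  then show ?thesis
    unfolding local_polytope_P3_def mem_Collect_eq
    by (intro exI[of _ ?p] exI[of _ ?q] exI[of _ ?A] exI[of _ ?B] exI[of _ ?C] allI)
qed

theorem theorem2:
  fixes S0 S1 T0 T1 U0 U1 S0' S1' T0' T1' U0' U1' :: bool
  assumes "D = strategy_vec S0 S1 \<otimes> strategy_vec T0 T1 \<otimes> strategy_vec U0 U1"
    and "D' = strategy_vec S0' S1' \<otimes> strategy_vec T0' T1' \<otimes> strategy_vec U0' U1'"
  shows "closed_segment (behaviour_of D) (behaviour_of D') \<subseteq> local_polytope_P3 \<longleftrightarrow>
         strategy_vec S0 S1 = strategy_vec S0' S1' \<or> strategy_vec U0 U1 = strategy_vec U0' U1'"
    (is "?segment \<longleftrightarrow> ?agree")
proof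
  define S S' T T' U U' where out_defs:
    "S = (\<lambda>s. if s then S1 else S0)" "S' = (\<lambda>s. if s then S1' else S0')"
    "T = (\<lambda>t. if t then T1 else T0)" "T' = (\<lambda>t. if t then T1' else T0')"
    "U = (\<lambda>u. if u then U1 else U0)" "U' = (\<lambda>u. if u then U1' else U0')"
  have D: "behaviour_of D $ (x, y, z, s, t, u) = of_bool (x = S s \<and> y = T t \<and> z = U u)"
    and D': "behaviour_of D' $ (x, y, z, s, t, u) = of_bool (x = S' s \<and> y = T' t \<and> z = U' u)"
    for x y z s t u
    unfolding assms behaviour_of_deterministic of_bool_def out_defs by (rule refl)+
  have eqS: "strategy_vec S0 S1 = strategy_vec S0' S1' \<longleftrightarrow> S = S'"
    and eqU: "strategy_vec U0 U1 = strategy_vec U0' U1' \<longleftrightarrow> U = U'"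
    unfolding strategy_vec_eq_iff out_defs fun_eq_iff by (simp_all add: all_bool_eq conj_commute)
  {
    assume seg: ?segment
    show ?agree
    proof (rule ccontr)
      assume "\<not> ?agree"
      then obtain s u where ne: "S s \<noteq> S' s" "U u \<noteq> U' u"
        unfolding eqS eqU by (auto simp: fun_eq_iff)
      \<comment> \<open>On settings \<open>s\<close>, \<open>u\<close> the outer outcomes are
        perfectly correlated here: only \<open>(S s, U u)\<close> and \<open>(S' s, U' u)\<close>
        occur.\<close>
      let ?M = "midpoint (behaviour_of D) (behaviour_of D')"
      have M: "?M $ (x, y, z, s, t, u) = (of_bool (x = S s \<and> y = T t \<and> z = U u)
          + of_bool (x = S' s \<and> y = T' t \<and> z = U' u)) / 2" for x y z t
        by (simp add: midpoint_def D D' del: of_bool_conj)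
      have "?M \<in> local_polytope_P3"
        using seg midpoint_in_closed_segment by blast
      \<comment> \<open>The middle setting is arbitrary, but must be the same in both
        events.\<close>
      moreover have "?M $ (S s, T False, U u, s, False, u) \<noteq> 0"
          "?M $ (S' s, T' False, U' u, s, False, u) \<noteq> 0"
        unfolding M by simp_all
      ultimately obtain y where "?M $ (S s, y, U' u, s, False, u) \<noteq> 0"
        using local_polytope_P3_outer_support by blast
      \<comment> \<open>The first summand of \<open>?M\<close> vanishes as \<open>U' u\<close>
        differs from \<open>U u\<close>, the second as \<open>S s\<close> differs from
        \<open>S' s\<close>.\<close>
      then show False
        unfolding M using ne by auto
    qed
  next
    assume agree: ?agree
    show ?segment
    proof
      fix P assume "P \<in> closed_segment (behaviour_of D) (behaviour_of D')"
      then obtain r where r: "0 \<le> r" "r \<le> 1"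
        and P: "P = (1 - r) *\<^sub>R behaviour_of D + r *\<^sub>R behaviour_of D'"
        unfolding in_segment by blast
      have mix: "P $ (x, y, z, s, t, u) = (1 - r) * of_bool (x = S s \<and> y = T t \<and> z = U u)
          + r * of_bool (x = S' s \<and> y = T' t \<and> z = U' u)" for x y z s t u
        unfolding P by (simp add: D D' del: of_bool_conj)
      from agree show "P \<in> local_polytope_P3"
        unfolding eqS eqU
      proof
        assume "S = S'"
        \<comment> \<open>The first source is trivial (bias 0). The coin \<open>j\<close> of the
          second is true with probability \<open>r\<close> and then selects the strategies of
          \<open>D'\<close>.\<close>
        show ?thesis
          by (rule two_coins_in_local_polytope_P3[where \<alpha> = 0 and \<beta> = r and a = "\<lambda>s i. S s"
                and b = "\<lambda>t i j. if j then T' t else T t" and c = "\<lambda>u j. if j then U' u else U u"])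
            (use r in \<open>simp_all add: mix UNIV_bool \<open>S = S'\<close> del: of_bool_conj\<close>)
      next
        assume "U = U'"
        \<comment> \<open>Mirror image: the coin \<open>i\<close> of the first source makes the
          selection.\<close>
        show ?thesis
          by (rule two_coins_in_local_polytope_P3[where \<alpha> = r and \<beta> = 0 and c = "\<lambda>u j. U u"
                and b = "\<lambda>t i j. if i then T' t else T t" and a = "\<lambda>s i. if i then S' s else S s"])
            (use r in \<open>simp_all add: mix UNIV_bool \<open>U = U'\<close> del: of_bool_conj\<close>)
      qed
    qed
  }
qed

end
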